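(* Let $\kappa$ be an algebraically closed field, $G$ a group and $\sigma\in pm(G)$ a factor set with total domain, i.e. $\sigma(g,h)\neq0$ for all $g,h\in G$. Then for all $x,y,z\in G$: $$[x]^\sigma[y]^\sigma[z]^\sigma=0\ \text{ in }\kappa_{par}^\sigma G\iff\sigma(x,y)\sigma(xy,z)\neq\sigma(x,yz)\sigma(y,z).$$
   Context: Algebras are associative and unital. A partial projective $\sigma$-representation of $G$ in a unital $\kappa$-algebra $R$ (with $1_R\neq 0$) is a map $\Gamma:G\to R$ for which there is a function $\sigma:G\times G\to\kappa$ (called the factor set) such that for all $g,h\in G$: (i) if $\sigma(g,h)=0$ then $\Gamma(g^{-1})\Gamma(gh)=0$ and $\Gamma(gh)\Gamma(h^{-1})=0$; (ii) if $\Gamma(g)\Gamma(h)=0$ then $\sigma(g,h)=0$; (iii) $\Gamma(1_G)=1_R$; (iv) $\Gamma(g^{-1})\Gamma(g)\Gamma(h)=\sigma(g,h)\Gamma(g^{-1})\Gamma(gh)$; (v) $\Gamma(g)\Gamma(h)\Gamma(h^{-1})=\sigma(g,h)\Gamma(gh)\Gamma(h^{-1})$. The set of all factor sets of $G$ (over all such $R$ and $\Gamma$) is $pm(G)$. For $\sigma\in pm(G)$, the twisted partial group algebra $\kappa_{par}^{\sigma}G$ is the universal $\kappa$-algebra generated by symbols $[g]^\sigma$ ($g\in G$) subject to, for all $g,h\in G$: $\sigma(g,h)=0\Rightarrow [g^{-1}]^\sigma[gh]^\sigma=[gh]^\sigma[h^{-1}]^\sigma=0$; $[g^{-1}]^\sigma[g]^\sigma[h]^\sigma=\sigma(g,h)[g^{-1}]^\sigma[gh]^\sigma$;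 $[g]^\sigma[h]^\sigma[h^{-1}]^\sigma=\sigma(g,h)[gh]^\sigma[h^{-1}]^\sigma$; $[g]^\sigma[1_G]^\sigma=[1_G]^\sigma[g]^\sigma=[g]^\sigma$. *)

theory Defs
  imports "HOL-Algebra.Algebra" "HOL-Algebra.Algebraic_Closure_Type" "HOL-Library.Poly_Mapping"
begin

(* Associative unital algebras over a field; "ring_1" includes 0 \<noteq> 1. *)
locale unital_algebra = vector_space scale
  for scale :: "'k::field \<Rightarrow> 'r::ring_1 \<Rightarrow> 'r" (infixr \<open>*\<^sub>k\<close> 75) +
  assumes scale_mult_left: "(c *\<^sub>k a) * b = c *\<^sub>k (a * b)"
    and scale_mult_right: "a * (c *\<^sub>k b) = c *\<^sub>k (a * b)"

definition partial_projective_rep ::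
  "('g, 'm) monoid_scheme \<Rightarrow> ('k::field \<Rightarrow> 'r::ring_1 \<Rightarrow> 'r) \<Rightarrow> ('g \<Rightarrow> 'g \<Rightarrow> 'k) \<Rightarrow> ('g \<Rightarrow> 'r) \<Rightarrow> bool"
where
  "partial_projective_rep G scale \<sigma> \<Gamma> \<longleftrightarrow>
     unital_algebra scale \<and>
     \<Gamma> \<one>\<^bsub>G\<^esub> = 1 \<and>
     (\<forall>g\<in>carrier G. \<forall>h\<in>carrier G.
        (\<sigma> g h = 0 \<longrightarrow>
           \<Gamma> (inv\<^bsub>G\<^esub> g) * \<Gamma> (g \<otimes>\<^bsub>G\<^esub> h) = 0 \<and> \<Gamma> (g \<otimes>\<^bsub>G\<^esub> h) * \<Gamma> (inv\<^bsub>G\<^esub> h) = 0) \<and>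
        (\<Gamma> g * \<Gamma> h = 0 \<longrightarrow> \<sigma> g h = 0) \<and>
        \<Gamma> (inv\<^bsub>G\<^esub> g) * \<Gamma> g * \<Gamma> h = scale (\<sigma> g h) (\<Gamma> (inv\<^bsub>G\<^esub> g) * \<Gamma> (g \<otimes>\<^bsub>G\<^esub> h)) \<and>
        \<Gamma> g * \<Gamma> h * \<Gamma> (inv\<^bsub>G\<^esub> h) = scale (\<sigma> g h) (\<Gamma> (g \<otimes>\<^bsub>G\<^esub> h) * \<Gamma> (inv\<^bsub>G\<^esub> h)))"

(* HOL cannot quantify over types inside a formula, so the type of the target algebra is an
   explicit parameter. In a theorem with hypothesis "\<sigma> \<in> pm TYPE('r) G" the variable 'r is
   universally quantified, which amounts to the existence of some target algebra. *)
definition pm :: "'r::ring_1 itself \<Rightarrow> ('g, 'm) monoid_scheme \<Rightarrow> ('g \<Rightarrow> 'g \<Rightarrow> 'k::field) set" where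
  "pm (_ :: 'r itself) G =
     {\<sigma>. \<exists>(scale :: 'k \<Rightarrow> 'r \<Rightarrow> 'r) \<Gamma>. partial_projective_rep G scale \<sigma> \<Gamma>}"

(* Lists are made the free monoid (written additively, as the key monoids of Poly_Mapping are),
   so that "'g list \<Rightarrow>\<^sub>0 'k" with its library multiplication is the free unital algebra on 'g. *)
instantiation list :: (type) monoid_add
begin
definition zero_list :: "'a list" where "zero_list = []"
definition plus_list :: "'a list \<Rightarrow> 'a list \<Rightarrow> 'a list" where "plus_list = (@)"
instance by standard (auto simp: zero_list_def plus_list_def)
end

definition free_algebra :: "'g set \<Rightarrow> ('g list \<Rightarrow>\<^sub>0 'k::field) ring" where
  "free_algebra A = ring_of_type_algebra\<lparr>carrier := {p. Poly_Mapping.keys p \<subseteq> lists A}\<rparr>"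

abbreviation word :: "'g list \<Rightarrow> ('g list \<Rightarrow>\<^sub>0 'k::field)" where
  "word w \<equiv> Poly_Mapping.single w 1"

(* "Poly_Mapping.single w c" is the scalar multiple c of the word w.
   The last set says that the symbol of the neutral element is the unit (the empty word).
   The set before it only says that this symbol is neutral among the generators; on its own
   it would leave a second, superfluous unit in the free unital algebra. *)
definition twisted_relations ::
  "('g, 'm) monoid_scheme \<Rightarrow> ('g \<Rightarrow> 'g \<Rightarrow> 'k::field) \<Rightarrow> ('g list \<Rightarrow>\<^sub>0 'k) set"
where
  "twisted_relations G \<sigma> =
     {word [inv\<^bsub>G\<^esub> g, g \<otimes>\<^bsub>G\<^esub> h] | g h. g \<in> carrier G \<and> h \<in> carrier G \<and> \<sigma> g h = 0} \<union>
     {word [g \<otimes>\<^bsub>G\<^esub> h, inv\<^bsub>G\<^esub> h] | g h. g \<in> carrier G \<and> h \<in> carrier G \<and> \<sigma> g h = 0} \<union>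
     {word [inv\<^bsub>G\<^esub> g, g, h] - Poly_Mapping.single [inv\<^bsub>G\<^esub> g, g \<otimes>\<^bsub>G\<^esub> h] (\<sigma> g h) | g h.
        g \<in> carrier G \<and> h \<in> carrier G} \<union>
     {word [g, h, inv\<^bsub>G\<^esub> h] - Poly_Mapping.single [g \<otimes>\<^bsub>G\<^esub> h, inv\<^bsub>G\<^esub> h] (\<sigma> g h) | g h.
        g \<in> carrier G \<and> h \<in> carrier G} \<union>
     {word [g, \<one>\<^bsub>G\<^esub>] - word [g] | g. g \<in> carrier G} \<union>
     {word [\<one>\<^bsub>G\<^esub>, g] - word [g] | g. g \<in> carrier G} \<union>
     {word [\<one>\<^bsub>G\<^esub>] - word []}"

definition twisted_ideal ::
  "('g, 'm) monoid_scheme \<Rightarrow> ('g \<Rightarrow> 'g \<Rightarrow> 'k::field) \<Rightarrow> ('g list \<Rightarrow>\<^sub>0 'k) set"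
where
  "twisted_ideal G \<sigma> = Idl\<^bsub>free_algebra (carrier G)\<^esub> (twisted_relations G \<sigma>)"

(* The ideal is closed under scalars because the free algebra contains the constants
   "Poly_Mapping.single [] c"; they give the quotient its algebra structure. *)
definition twisted_partial_group_algebra ::
  "('g, 'm) monoid_scheme \<Rightarrow> ('g \<Rightarrow> 'g \<Rightarrow> 'k::field) \<Rightarrow> ('g list \<Rightarrow>\<^sub>0 'k) set ring"
where
  "twisted_partial_group_algebra G \<sigma> = free_algebra (carrier G) Quot twisted_ideal G \<sigma>"

definition bracket ::
  "('g, 'm) monoid_scheme \<Rightarrow> ('g \<Rightarrow> 'g \<Rightarrow> 'k::field) \<Rightarrow> 'g \<Rightarrow> ('g list \<Rightarrow>\<^sub>0 'k) set"
where
  "bracket G \<sigma> g = twisted_ideal G \<sigma> +>\<^bsub>free_algebra (carrier G)\<^esub> word [g]"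

lemma free_algebra_simps [simp]:
  "carrier (free_algebra A) = {p. Poly_Mapping.keys p \<subseteq> lists A}"
  "x \<otimes>\<^bsub>free_algebra A\<^esub> y = x * y"
  "x \<oplus>\<^bsub>free_algebra A\<^esub> y = x + y"
  "\<one>\<^bsub>free_algebra A\<^esub> = 1"
  "\<zero>\<^bsub>free_algebra A\<^esub> = 0"
  by (simp_all add: free_algebra_def ring_of_type_algebra_def)

lemma ring_free_algebra: "ring (free_algebra A :: ('g list \<Rightarrow>\<^sub>0 'k::field) ring)"
proof (rule ringI)
  show "abelian_group (free_algebra A :: ('g list \<Rightarrow>\<^sub>0 'k) ring)"
  proof (rule abelian_groupI)
    fix x y :: "'g list \<Rightarrow>\<^sub>0 'k"
    assume "x \<in> carrier (free_algebra A)" "y \<in> carrier (free_algebra A)"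
    then show "x \<oplus>\<^bsub>free_algebra A\<^esub> y \<in> carrier (free_algebra A)"
      using keys_add[of x y] by auto
  next
    fix x :: "'g list \<Rightarrow>\<^sub>0 'k"
    assume "x \<in> carrier (free_algebra A)"
    then show "\<exists>y\<in>carrier (free_algebra A). y \<oplus>\<^bsub>free_algebra A\<^esub> x = \<zero>\<^bsub>free_algebra A\<^esub>"
      by (intro bexI[of _ "- x"]) simp_all
  qed (auto simp: algebra_simps)
  have "Poly_Mapping.keys (x * y) \<subseteq> lists A"
    if "Poly_Mapping.keys x \<subseteq> lists A" "Poly_Mapping.keys y \<subseteq> lists A"
    for x y :: "'g list \<Rightarrow>\<^sub>0 'k"
  proof
    fix w assume "w \<in> Poly_Mapping.keys (x * y)"
    then obtain u v where "u \<in> Poly_Mapping.keys x" "v \<in> Poly_Mapping.keys y" "w = u @ v"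
      using keys_mult[of x y] by (auto simp: plus_list_def)
    then show "w \<in> lists A" using that by auto
  qed
  then show "monoid (free_algebra A :: ('g list \<Rightarrow>\<^sub>0 'k) ring)"
    by unfold_locales (auto simp: mult.assoc zero_list_def)
qed (auto simp: algebra_simps)

lemma ideal_twisted_ideal:
  assumes "group G"
  shows "ideal (twisted_ideal G (\<sigma> :: 'g \<Rightarrow> 'g \<Rightarrow> 'k::field)) (free_algebra (carrier G))"
proof -
  interpret group G by fact
  have "twisted_relations G \<sigma> \<subseteq> carrier (free_algebra (carrier G))"
    unfolding twisted_relations_def by (auto dest!: subsetD[OF keys_diff] split: if_splits)
  then show ?thesis
    unfolding twisted_ideal_def by (rule ring.genideal_ideal[OF ring_free_algebra])
qed

lemma ring_twisted_partial_group_algebra: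
  "group G \<Longrightarrow> ring (twisted_partial_group_algebra G \<sigma>)"
  unfolding twisted_partial_group_algebra_def
  by (rule ideal.quotient_is_ring[OF ideal_twisted_ideal])

end

theory Submission
  imports Defs
begin

text \<open>
  Put \<open>e\<^sub>g = [g][g\<inverse>]\<close> and \<open>f\<^sub>g = [g\<inverse>][g]\<close>. Both \<open>\<sigma>(x,y)\<sigma>(xy,z) e\<^sub>x[xyz]f\<^sub>z\<close> and
  \<open>\<sigma>(x,yz)\<sigma>(y,z) e\<^sub>x[xyz]f\<^sub>z\<close> equal the same nonzero multiple of \<open>[x][y][z]\<close>, so a failure of the cocycle
  identity forces the product to vanish. The same computation in a partial projective representation
  \<open>\<Gamma>\<close> shows that the identity can only fail when \<open>\<Gamma>(x)\<Gamma>(y)\<Gamma>(z) = 0\<close>; as \<open>\<Gamma>(g)\<Gamma>(h) \<noteq> 0\<close>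
  for a total factor set, the identity always holds on degenerate triples, i.e. when two of the vertices
  \<open>1, z, yz, xyz\<close> coincide.

  Conversely, if the identity holds at \<open>(x,y,z)\<close>, it holds on every triple whose vertices lie in
  \<open>A = {1, z, yz, xyz}\<close>. Hence \<open>\<delta>\<^sub>a \<mapsto> \<sigma>(g,a) \<delta>\<^bsub>ga\<^esub>\<close> for \<open>a, ga \<in> A\<close>, and \<open>\<delta>\<^sub>a \<mapsto> 0\<close> otherwise,
  respects the defining relations, while \<open>[x][y][z]\<close> sends \<open>\<delta>\<^sub>1\<close> to a nonzero multiple of
  \<open>\<delta>\<^bsub>xyz\<^esub>\<close>.
\<close>

section \<open>Total factor sets and the symmetry of the cocycle identity\<close>

definition cocycle_at :: "('g, 'm) monoid_scheme \<Rightarrow> ('g \<Rightarrow> 'g \<Rightarrow> 'k::field) \<Rightarrow> 'g \<Rightarrow> 'g \<Rightarrow> 'g \<Rightarrow> bool" where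
  "cocycle_at G \<sigma> g h k \<longleftrightarrow>
     \<sigma> g h * \<sigma> (g \<otimes>\<^bsub>G\<^esub> h) k = \<sigma> g (h \<otimes>\<^bsub>G\<^esub> k) * \<sigma> h k"

text \<open>The six elements in \<open>cocycle_at_degenerate\<close> are the edges of the simplex
  with vertices \<open>\<one>\<close>, \<open>k\<close>, \<open>h \<otimes> k\<close>,
  \<open>g \<otimes> h \<otimes> k\<close>; one of them is \<open>\<one>\<close> exactly when two
  vertices coincide.\<close>

locale total_factor_set = group G for G :: "('g, 'm) monoid_scheme" (structure) +
  fixes \<sigma> :: "'g \<Rightarrow> 'g \<Rightarrow> 'k::field"
  assumes nonzero: "\<lbrakk>g \<in> carrier G; h \<in> carrier G\<rbrakk> \<Longrightarrow> \<sigma> g h \<noteq> 0"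
    and normalized: "\<sigma> \<one> \<one> = 1"
    and cocycle_at_degenerate:
      "\<lbrakk>g \<in> carrier G; h \<in> carrier G; k \<in> carrier G;
        \<one> \<in> {g, h, k, g \<otimes> h, h \<otimes> k, g \<otimes> h \<otimes> k}\<rbrakk> \<Longrightarrow> cocycle_at G \<sigma> g h k"
begin

text \<open>The degenerate triple \<open>(\<one>, \<one>, g)\<close> makes the nonzero scalar
  \<open>\<sigma> \<one> g\<close> equal to its own square.\<close>

lemma factor_one_left: "g \<in> carrier G \<Longrightarrow> \<sigma> \<one> g = 1"
  using cocycle_at_degenerate[of \<one> \<one> g] nonzero[of \<one> g] normalized
  by (simp add: cocycle_at_def)

text \<open>The five faces of a 4-simplex carry one multiplicative relation, so four cocycle
  identities give the fifth, here after cancelling \<open>\<sigma> h k\<close>.\<close>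

lemma pentagon_middle:
  assumes "g \<in> carrier G" "h \<in> carrier G" "k \<in> carrier G" "l \<in> carrier G"
    and "cocycle_at G \<sigma> g h k" "cocycle_at G \<sigma> (g \<otimes> h) k l" "cocycle_at G \<sigma> g h (k \<otimes> l)"
    and "cocycle_at G \<sigma> h k l"
  shows "cocycle_at G \<sigma> g (h \<otimes> k) l"
proof -
  have nz: "\<sigma> h k \<noteq> 0"
    using assms by (simp add: nonzero)
  have e1: "\<sigma> g h * \<sigma> (g \<otimes> h) k = \<sigma> g (h \<otimes> k) * \<sigma> h k"
    and e2: "\<sigma> (g \<otimes> h) k * \<sigma> (g \<otimes> (h \<otimes> k)) l = \<sigma> (g \<otimes> h) (k \<otimes> l) * \<sigma> k l"
    and e3: "\<sigma> g h * \<sigma> (g \<otimes> h) (k \<otimes> l) = \<sigma> g (h \<otimes> k \<otimes> l) * \<sigma> h (k \<otimes> l)"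
    and e4: "\<sigma> h k * \<sigma> (h \<otimes> k) l = \<sigma> h (k \<otimes> l) * \<sigma> k l"
    using assms by (simp_all add: cocycle_at_def m_assoc)
  have "\<sigma> h k * (\<sigma> g (h \<otimes> k) * \<sigma> (g \<otimes> (h \<otimes> k)) l)
      = \<sigma> g h * (\<sigma> (g \<otimes> h) k * \<sigma> (g \<otimes> (h \<otimes> k)) l)"
    using e1 by (simp add: ac_simps)
  also have "\<dots> = \<sigma> g (h \<otimes> k \<otimes> l) * (\<sigma> h (k \<otimes> l) * \<sigma> k l)"
    unfolding e2 using e3 by (simp add: mult.assoc[symmetric])
  also have "\<dots> = \<sigma> h k * (\<sigma> g (h \<otimes> k \<otimes> l) * \<sigma> (h \<otimes> k) l)"
    unfolding e4[symmetric] by (simp add: ac_simps)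
  finally show ?thesis using nz by (simp add: cocycle_at_def)
qed

text \<open>The same relation solved for another face; the cancelled factor is
  \<open>\<sigma> k l\<close>.\<close>

lemma pentagon_last:
  assumes "g \<in> carrier G" "h \<in> carrier G" "k \<in> carrier G" "l \<in> carrier G"
    and "cocycle_at G \<sigma> g h k" "cocycle_at G \<sigma> h k l" "cocycle_at G \<sigma> g (h \<otimes> k) l"
    and "cocycle_at G \<sigma> (g \<otimes> h) k l"
  shows "cocycle_at G \<sigma> g h (k \<otimes> l)"
proof -
  have nz: "\<sigma> h k \<noteq> 0" "\<sigma> k l \<noteq> 0"
    using assms by (simp_all add: nonzero)
  have e1: "\<sigma> g h * \<sigma> (g \<otimes> h) k = \<sigma> g (h \<otimes> k) * \<sigma> h k"
    and e2: "\<sigma> (g \<otimes> h) k * \<sigma> (g \<otimes> (h \<otimes> k)) l = \<sigma> (g \<otimes> h) (k \<otimes> l) * \<sigma> k l"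
    and e3: "\<sigma> h k * \<sigma> (h \<otimes> k) l = \<sigma> h (k \<otimes> l) * \<sigma> k l"
    and e4: "\<sigma> g (h \<otimes> k) * \<sigma> (g \<otimes> (h \<otimes> k)) l = \<sigma> g (h \<otimes> k \<otimes> l) * \<sigma> (h \<otimes> k) l"
    using assms by (simp_all add: cocycle_at_def m_assoc)
  have "\<sigma> k l * (\<sigma> g h * \<sigma> (g \<otimes> h) (k \<otimes> l)) = \<sigma> g h * (\<sigma> (g \<otimes> h) k * \<sigma> (g \<otimes> (h \<otimes> k)) l)"
    using e2 by (simp add: ac_simps)
  also have "\<dots> = \<sigma> h k * (\<sigma> g (h \<otimes> k) * \<sigma> (g \<otimes> (h \<otimes> k)) l)"
    using e1 by (simp add: mult.assoc[symmetric] mult.commute[of "\<sigma> h k"])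
  also have "\<dots> = \<sigma> g (h \<otimes> k \<otimes> l) * (\<sigma> h k * \<sigma> (h \<otimes> k) l)"
    using e4 by (simp add: ac_simps)
  also have "\<dots> = \<sigma> k l * (\<sigma> g (h \<otimes> k \<otimes> l) * \<sigma> h (k \<otimes> l))"
    unfolding e3 by (simp add: ac_simps)
  finally show ?thesis
    using nz assms by (simp add: cocycle_at_def m_assoc)
qed

text \<open>\<^term>\<open>cocycle_on a b c\<close> is the cocycle identity of the simplex with vertices
  \<open>\<one>, a, b, c\<close>. In this form the identity is symmetric in \<open>a, b, c\<close>: inserting a repeated vertex
  into the pentagon identity makes all but two of its five faces degenerate.\<close>

definition cocycle_on :: "'g \<Rightarrow> 'g \<Rightarrow> 'g \<Rightarrow> bool" where
  "cocycle_on a b c \<longleftrightarrow> cocycle_at G \<sigma> (c \<otimes> inv b) (b \<otimes> inv a) a"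

lemma cancel_middle:
  assumes "a \<in> carrier G" "b \<in> carrier G" "c \<in> carrier G"
  shows "(c \<otimes> inv b) \<otimes> (b \<otimes> inv a) = c \<otimes> inv a" "b \<otimes> inv a \<otimes> a = b"
proof -
  have "inv b \<otimes> (b \<otimes> inv a) = inv a"
    using assms by (simp add: m_assoc[symmetric])
  then show "c \<otimes> inv b \<otimes> (b \<otimes> inv a) = c \<otimes> inv a" "b \<otimes> inv a \<otimes> a = b"
    using assms by (simp_all add: m_assoc)
qed

lemma cocycle_on_degenerate:
  assumes "a \<in> carrier G" "b \<in> carrier G" "c \<in> carrier G"
    and "\<not> distinct [\<one>, a, b, c]"
  shows "cocycle_on a b c"
  unfolding cocycle_on_def
  using assms cancel_middle[OF assms(1-3)] cancel_middle(2)[of a c]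
  by (intro cocycle_at_degenerate) auto

text \<open>Take the pentagon on the vertices \<open>\<one>, a, b, c, b\<close>: omitting one copy
  of \<open>b\<close> gives the known face or the wanted one, and the other three faces contain both
  copies.\<close>

lemma cocycle_on_swap_last:
  assumes "a \<in> carrier G" "b \<in> carrier G" "c \<in> carrier G" "cocycle_on a b c"
  shows "cocycle_on a c b"
proof -
  have "b \<otimes> inv c \<otimes> (c \<otimes> inv b) = \<one>"
    using assms by (simp add: cancel_middle)
  then show ?thesis
    using assms pentagon_middle[of "b \<otimes> inv c" "c \<otimes> inv b" "b \<otimes> inv a" a]
    by (simp add: cocycle_on_def cocycle_at_degenerate cancel_middle)
qed

text \<open>Likewise with the vertices \<open>\<one>, a, b, a, c\<close>, where \<open>a\<close> is
  repeated.\<close>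

lemma cocycle_on_swap_first:
  assumes "a \<in> carrier G" "b \<in> carrier G" "c \<in> carrier G" "cocycle_on a b c"
  shows "cocycle_on b a c"
proof -
  have "a \<otimes> inv b \<otimes> (b \<otimes> inv a) = \<one>"
    using assms by (simp add: cancel_middle)
  then show ?thesis
    using assms pentagon_last[of "c \<otimes> inv a" "a \<otimes> inv b" "b \<otimes> inv a" a]
    by (simp add: cocycle_on_def cocycle_at_degenerate cancel_middle)
qed

text \<open>A nondegenerate choice is a permutation of \<open>p, q, r\<close>, and the two adjacent
  swaps generate all of these.\<close>

lemma cocycle_on_closed:
  assumes "p \<in> carrier G" "q \<in> carrier G" "r \<in> carrier G" "cocycle_on p q r"
    and "a \<in> {\<one>, p, q, r}" "b \<in> {\<one>, p, q, r}" "c \<in> {\<one>, p, q, r}"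
  shows "cocycle_on a b c"
proof (cases "distinct [\<one>, a, b, c]")
  case True
  note swaps = cocycle_on_swap_first cocycle_on_swap_last
  have 1: "cocycle_on q p r" "cocycle_on p r q" using assms swaps by blast+
  then have 2: "cocycle_on q r p" "cocycle_on r p q" using assms swaps by blast+
  then have 3: "cocycle_on r q p" using assms swaps by blast
  show ?thesis using True assms(4-) 1 2 3 by auto
next
  case False
  then show ?thesis using assms by (intro cocycle_on_degenerate) auto
qed

end

section \<open>From a representation to degenerate cocycle identities\<close>

lemma (in unital_algebra) total_factor_set_if_rep:
  fixes G (structure)
  assumes "group G" and rep: "partial_projective_rep G scale \<sigma> \<Gamma>"
    and nz: "\<And>g h. g \<in> carrier G \<Longrightarrow> h \<in> carrier G \<Longrightarrow> \<sigma> g h \<noteq> 0"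
  shows "total_factor_set G \<sigma>"
proof -
  interpret group G by fact
  have one: "\<Gamma> \<one> = 1" using rep by (simp add: partial_projective_rep_def)
  have prod: "\<Gamma> g * \<Gamma> h \<noteq> 0" if "g \<in> carrier G" "h \<in> carrier G" for g h
    using rep nz that by (auto simp: partial_projective_rep_def)
  have L: "\<Gamma> (inv g) * \<Gamma> g * \<Gamma> h = scale (\<sigma> g h) (\<Gamma> (inv g) * \<Gamma> (g \<otimes> h))"
    and R: "\<Gamma> g * \<Gamma> h * \<Gamma> (inv h) = scale (\<sigma> g h) (\<Gamma> (g \<otimes> h) * \<Gamma> (inv h))"
    if "g \<in> carrier G" "h \<in> carrier G" for g h
    using rep that by (auto simp: partial_projective_rep_def)
  \<comment> \<open>Each \<open>\<Gamma> g\<close> is von Neumann regular up to a nonzero scalar,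
    which \<open>L\<close> and \<open>R\<close> express in two ways.\<close>
  have reg: "\<Gamma> g * \<Gamma> (inv g) * \<Gamma> g = scale (\<sigma> (inv g) g) (\<Gamma> g)"
    "\<Gamma> g * \<Gamma> (inv g) * \<Gamma> g = scale (\<sigma> g (inv g)) (\<Gamma> g)" if "g \<in> carrier G" for g
    using L[of "inv g" g] R[of g "inv g"] that by (simp_all add: one)
  have cocycle: "cocycle_at G \<sigma> g h k"
    if *: "g \<in> carrier G" "h \<in> carrier G" "k \<in> carrier G" and n0: "\<Gamma> g * \<Gamma> h * \<Gamma> k \<noteq> 0" for g h k
  proof -
    \<comment> \<open>\<open>?N\<close> is the triple product with the padding that \<open>L\<close>
      needs on the left and \<open>R\<close> on the right; \<open>?W\<close> is the common result of
      contracting the middle in either order.\<close>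
    let ?N = "\<Gamma> g * \<Gamma> (inv g) * \<Gamma> g * \<Gamma> h * (\<Gamma> k * \<Gamma> (inv k) * \<Gamma> k)"
    let ?W = "\<Gamma> g * (\<Gamma> (inv g) * (\<Gamma> (g \<otimes> h \<otimes> k) * (\<Gamma> (inv k) * \<Gamma> k)))"
    have "?N = \<Gamma> g * (\<Gamma> (inv g) * \<Gamma> g * \<Gamma> h) * \<Gamma> k * \<Gamma> (inv k) * \<Gamma> k"
      by (simp add: mult.assoc)
    also have "\<dots> = scale (\<sigma> g h) (\<Gamma> g * (\<Gamma> (inv g) * (\<Gamma> (g \<otimes> h) * \<Gamma> k * \<Gamma> (inv k)) * \<Gamma> k))"
      unfolding L[OF *(1,2)] by (simp add: scale_mult_left scale_mult_right mult.assoc)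
    also have "\<dots> = scale (\<sigma> g h * \<sigma> (g \<otimes> h) k) ?W"
      unfolding R[OF m_closed[OF *(1,2)] *(3)]
      by (simp add: scale_mult_left scale_mult_right mult.assoc)
    finally have 1: "?N = scale (\<sigma> g h * \<sigma> (g \<otimes> h) k) ?W" .
    have "?N = \<Gamma> g * \<Gamma> (inv g) * \<Gamma> g * (\<Gamma> h * \<Gamma> k * \<Gamma> (inv k)) * \<Gamma> k"
      by (simp add: mult.assoc)
    also have "\<dots> = scale (\<sigma> h k) (\<Gamma> g * (\<Gamma> (inv g) * \<Gamma> g * \<Gamma> (h \<otimes> k)) * \<Gamma> (inv k) * \<Gamma> k)"
      unfolding R[OF *(2,3)] by (simp add: scale_mult_left scale_mult_right mult.assoc)
    also have "\<dots> = scale (\<sigma> g (h \<otimes> k) * \<sigma> h k) ?W"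
      unfolding L[OF *(1) m_closed[OF *(2,3)]]
      by (simp add: scale_mult_left scale_mult_right mult.assoc m_assoc * mult.commute[of "\<sigma> h k"])
    finally have 2: "?N = scale (\<sigma> g (h \<otimes> k) * \<sigma> h k) ?W" .
    have "?N = scale (\<sigma> (inv g) g * \<sigma> k (inv k)) (\<Gamma> g * \<Gamma> h * \<Gamma> k)"
      unfolding reg(1)[OF *(1)] reg(2)[OF *(3)]
      by (simp add: scale_mult_left scale_mult_right)
    then have "?N \<noteq> 0" using n0 nz * by simp
    \<comment> \<open>As \<open>?N\<close> is nonzero, so is \<open>?W\<close>, and the two scalars
      in front of it agree.\<close>
    then show ?thesis using 1 2 unfolding cocycle_at_def by (metis scale_cancel_right scale_zero_right)
  qed
  show ?thesis
  proof (unfold_locales, fact nz)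
    show "\<sigma> \<one> \<one> = 1"
      using L[of \<one> \<one>] by (simp add: one) (metis scale_cancel_right scale_one one_neq_zero)
  next
    fix g h k
    assume *: "g \<in> carrier G" "h \<in> carrier G" "k \<in> carrier G"
      and deg: "\<one> \<in> {g, h, k, g \<otimes> h, h \<otimes> k, g \<otimes> h \<otimes> k}"
    have "\<Gamma> g * \<Gamma> h * \<Gamma> k \<noteq> 0"
    proof -
      consider "g = \<one>" | "h = \<one>" | "k = \<one>" | "g \<otimes> h = \<one>" | "h \<otimes> k = \<one>" | "g \<otimes> h \<otimes> k = \<one>"
        using deg by auto
      then show ?thesis
      proof cases
        case 4
        then have "g = inv h" using * by (simp add: inv_equality)
        then show ?thesis using L[of h k] * nz prod by simp
      next
        case 5
        then have "k = inv h" using * by (metis inv_equality inv_inv inv_closed)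
        then show ?thesis using R[of g h] * nz prod by simp
      next
        case 6
        then have h: "h = inv g \<otimes> inv k"
          using * by (metis inv_closed inv_equality inv_inv m_assoc m_closed inv_mult_group inv_solve_left)
        \<comment> \<open>No relation contracts the triple product itself. But \<open>?P\<close> is
          a multiple of it, and enclosing \<open>?P\<close> between \<open>\<Gamma> (inv g)\<close>
          and \<open>\<Gamma> (inv k)\<close> yields, by regularity, a nonzero multiple of a product
          of two factors.\<close>
        let ?P = "\<Gamma> g * \<Gamma> (inv g) * \<Gamma> (inv k) * \<Gamma> k"
        have P: "?P = scale (\<sigma> (inv g) (inv k)) (\<Gamma> g * \<Gamma> h * \<Gamma> k)"
          using L[of "inv g" "inv k"] * by (simp add: h scale_mult_left)
        have "\<Gamma> (inv g) * ?P * \<Gamma> (inv k)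
            = (\<Gamma> (inv g) * \<Gamma> g * \<Gamma> (inv g)) * (\<Gamma> (inv k) * \<Gamma> k * \<Gamma> (inv k))"
          by (simp add: mult.assoc)
        also have "\<dots> = scale (\<sigma> g (inv g) * \<sigma> k (inv k)) (\<Gamma> (inv g) * \<Gamma> (inv k))"
          using reg(1)[of "inv g"] reg(1)[of "inv k"] * 
          by (simp add: scale_mult_left scale_mult_right mult.commute)
        finally have "\<Gamma> (inv g) * ?P * \<Gamma> (inv k) \<noteq> 0"
          using * nz prod by simp
        then show ?thesis unfolding P by auto
      qed (use * prod in \<open>auto simp: one\<close>)
    qed
    then show "cocycle_at G \<sigma> g h k" using cocycle * by blast
  qed
qed

section \<open>Linear functionals on the free algebra and their ideals\<close>

definition linear_extension :: "('g list \<Rightarrow> 'k::field) \<Rightarrow> ('g list \<Rightarrow>\<^sub>0 'k) \<Rightarrow> 'k" where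
  "linear_extension \<phi> p = (\<Sum>w\<in>Poly_Mapping.keys p. Poly_Mapping.lookup p w * \<phi> w)"

text \<open>Keys may cancel in a sum, so additivity is proved over a common finite index
  set.\<close>

lemma linear_extension_superset:
  assumes "finite S" "Poly_Mapping.keys p \<subseteq> S"
  shows "linear_extension \<phi> p = (\<Sum>w\<in>S. Poly_Mapping.lookup p w * \<phi> w)"
  unfolding linear_extension_def using assms
  by (intro sum.mono_neutral_left) (auto simp: in_keys_iff)

lemma linear_extension_zero [simp]: "linear_extension \<phi> 0 = 0"
  by (simp add: linear_extension_def)

lemma linear_extension_add: "linear_extension \<phi> (p + q) = linear_extension \<phi> p + linear_extension \<phi> q"
proof -
  let ?S = "Poly_Mapping.keys p \<union> Poly_Mapping.keys q"
  have "linear_extension \<phi> r = (\<Sum>w\<in>?S. Poly_Mapping.lookup r w * \<phi> w)" if "r \<in> {p, q, p + q}" for r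
    using that keys_add[of p q] by (intro linear_extension_superset) auto
  then show ?thesis by (simp add: lookup_add distrib_right sum.distrib)
qed

lemma linear_extension_uminus: "linear_extension \<phi> (- p) = - linear_extension \<phi> p"
  using linear_extension_add[of \<phi> p "- p"] by (simp add: eq_neg_iff_add_eq_0 add.commute)

lemma linear_extension_diff: "linear_extension \<phi> (p - q) = linear_extension \<phi> p - linear_extension \<phi> q"
  using linear_extension_add[of \<phi> p "- q"] by (simp add: linear_extension_uminus)

lemma linear_extension_single [simp]: "linear_extension \<phi> (Poly_Mapping.single w c) = c * \<phi> w"
  by (simp add: linear_extension_def)

lemma poly_mapping_single_induct [case_names zero add]:
  fixes p :: "'a \<Rightarrow>\<^sub>0 'b::comm_monoid_add"
  assumes "P 0" and "\<And>w c q. P q \<Longrightarrow> P (Poly_Mapping.single w c + q)"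
  shows "P p"
proof (induction p rule: update_induct)
  case const
  then show ?case using assms(1) by simp
next
  case (update f a b)
  have "Poly_Mapping.update a b f = Poly_Mapping.single a b + f"
    using update by (intro poly_mapping_eqI) (auto simp: lookup_update lookup_add lookup_single in_keys_iff)
  then show ?case using assms(2) update by simp
qed

lemma linear_extension_single_mult:
  "linear_extension \<phi> (Poly_Mapping.single u c * p) = c * linear_extension (\<lambda>w. \<phi> (u @ w)) p"
  by (induction p rule: poly_mapping_single_induct)
    (simp_all add: linear_extension_add distrib_left mult_single plus_list_def mult.assoc)

lemma linear_extension_mult_single:
  "linear_extension \<phi> (p * Poly_Mapping.single v c) = c * linear_extension (\<lambda>w. \<phi> (w @ v)) p"
  by (induction p rule: poly_mapping_single_induct)
    (simp_all add: linear_extension_add distrib_right distrib_left mult_single plus_list_def ac_simps)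

text \<open>The inner functional is evaluated at the right factor, which suits left multiples of an
  ideal element; \<open>linear_extension_mult'\<close> is the mirror form for right
  multiples.\<close>

lemma linear_extension_mult:
  "linear_extension \<phi> (p * q) = linear_extension (\<lambda>u. linear_extension (\<lambda>v. \<phi> (u @ v)) q) p"
  by (induction p rule: poly_mapping_single_induct)
    (simp_all add: linear_extension_add distrib_right linear_extension_single_mult)

lemma linear_extension_mult':
  "linear_extension \<phi> (p * q) = linear_extension (\<lambda>v. linear_extension (\<lambda>u. \<phi> (u @ v)) p) q"
  by (induction q rule: poly_mapping_single_induct)
    (simp_all add: linear_extension_add distrib_left linear_extension_mult_single)

text \<open>The largest two-sided ideal on which the linear extension of \<open>\<phi>\<close> vanishes.\<close>

definition annihilator :: "'g set \<Rightarrow> ('g list \<Rightarrow> 'k::field) \<Rightarrow> ('g list \<Rightarrow>\<^sub>0 'k) set" where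
  "annihilator A \<phi> = {p \<in> carrier (free_algebra A).
     \<forall>u\<in>lists A. \<forall>v\<in>lists A. linear_extension (\<lambda>w. \<phi> (u @ w @ v)) p = 0}"

lemma annihilatorD:
  assumes "p \<in> annihilator A \<phi>" "u \<in> lists A" "v \<in> lists A"
  shows "linear_extension (\<lambda>w. \<phi> (u @ w @ v)) p = 0"
  using assms unfolding annihilator_def by blast

text \<open>Multiplication by \<open>x\<close> only lengthens the contexts \<open>u\<close> or
  \<open>v\<close>, and the defining condition ranges over all contexts.\<close>

lemma ideal_annihilator: "ideal (annihilator A \<phi>) (free_algebra A)"
proof -
  interpret ring "free_algebra A :: ('a list \<Rightarrow>\<^sub>0 'b) ring" by (rule ring_free_algebra)
  have zero: "linear_extension \<psi> p = 0"
    if "Poly_Mapping.keys p \<subseteq> lists A" "\<And>w. w \<in> lists A \<Longrightarrow> \<psi> w = 0" 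
    for p and \<psi> :: "'a list \<Rightarrow> 'b"
    using that unfolding linear_extension_def by (intro sum.neutral) (simp add: subset_iff)
  have inv: "\<ominus>\<^bsub>free_algebra A\<^esub> p = - p" if "p \<in> carrier (free_algebra A)" for p :: "'a list \<Rightarrow>\<^sub>0 'b"
    using that minus_equality[of "- p" p] by simp
  show ?thesis
  proof (rule idealI)
    show "ring (free_algebra A :: ('a list \<Rightarrow>\<^sub>0 'b) ring)" by (rule ring_free_algebra)
    show "subgroup (annihilator A \<phi>) (add_monoid (free_algebra A))"
    proof (rule add.subgroupI)
      show "annihilator A \<phi> \<noteq> {}"
        by (auto simp: annihilator_def intro!: exI[of _ 0])
    next
      fix a b assume ab: "a \<in> annihilator A \<phi>" "b \<in> annihilator A \<phi>"
      then have "a \<oplus>\<^bsub>free_algebra A\<^esub> b \<in> carrier (free_algebra A)"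
        by (intro a_closed) (auto simp: annihilator_def)
      then show "a \<oplus>\<^bsub>free_algebra A\<^esub> b \<in> annihilator A \<phi>"
        using ab by (simp add: annihilator_def linear_extension_add)
    qed (auto simp: annihilator_def inv linear_extension_uminus)
  next
    fix a x :: "'a list \<Rightarrow>\<^sub>0 'b"
    assume a: "a \<in> annihilator A \<phi>" and x: "x \<in> carrier (free_algebra A)"
    have "x \<otimes>\<^bsub>free_algebra A\<^esub> a \<in> carrier (free_algebra A)"
      "a \<otimes>\<^bsub>free_algebra A\<^esub> x \<in> carrier (free_algebra A)"
      using a x by (auto intro!: m_closed simp only: annihilator_def mem_Collect_eq)
    moreover have "linear_extension (\<lambda>w. \<phi> (u @ w @ v)) (x * a) = 0"
      if "u \<in> lists A" "v \<in> lists A" for u v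
      unfolding linear_extension_mult
    proof (rule zero)
      fix w assume "w \<in> lists A"
      then show "linear_extension (\<lambda>va. \<phi> (u @ (w @ va) @ v)) a = 0"
        using annihilatorD[OF a, of "u @ w" v] that by simp
    qed (use x in simp)
    moreover have "linear_extension (\<lambda>w. \<phi> (u @ w @ v)) (a * x) = 0"
      if "u \<in> lists A" "v \<in> lists A" for u v
      unfolding linear_extension_mult'
    proof (rule zero)
      fix w assume "w \<in> lists A"
      then show "linear_extension (\<lambda>ua. \<phi> (u @ (ua @ w) @ v)) a = 0"
        using annihilatorD[OF a, of u "w @ v"] that by simp
    qed (use x in simp)
    ultimately show "x \<otimes>\<^bsub>free_algebra A\<^esub> a \<in> annihilator A \<phi>"
      "a \<otimes>\<^bsub>free_algebra A\<^esub> x \<in> annihilator A \<phi>"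
      by (simp_all add: annihilator_def)
  qed
qed

section \<open>The truncated action of words\<close>

context total_factor_set
begin

text \<open>A word \<open>w\<close> acts on the span of \<open>A\<close> by
  \<open>\<delta>\<^sub>a \<mapsto> weight A w a \<cdot> \<delta>\<^bsub>position w a\<^esub>\<close>.\<close>

primrec position :: "'g list \<Rightarrow> 'g \<Rightarrow> 'g" where
  "position [] a = a"
| "position (g # w) a = g \<otimes> position w a"

primrec weight :: "'g set \<Rightarrow> 'g list \<Rightarrow> 'g \<Rightarrow> 'k" where
  "weight A [] a = 1"
| "weight A (g # w) a =
     (if g \<otimes> position w a \<in> A then \<sigma> g (position w a) * weight A w a else 0)"

lemma position_append: "position (u @ v) a = position u (position v a)"
  by (induction u) simp_all

lemma weight_append: "weight A (u @ v) a = weight A u (position v a) * weight A v a"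
  by (induction u) (simp_all add: position_append)

text \<open>Positions are tracked even outside \<open>A\<close>; truncation happens in the weight.
  The outermost letter tests the final position, and the empty word stays at
  \<open>a\<close>.\<close>

lemma weight_eq_0: "a \<in> A \<Longrightarrow> position w a \<notin> A \<Longrightarrow> weight A w a = 0"
  by (cases w) auto

text \<open>Equal action on the points of \<open>A\<close> suffices in every context: if
  \<open>v\<close> moves \<open>\<one>\<close> out of \<open>A\<close>, its weight vanishes and so
  do both sides.\<close>

lemma binomial_in_annihilator:
  assumes A: "\<one> \<in> A" "A \<subseteq> carrier G"
    and words: "s \<in> lists (carrier G)" "t \<in> lists (carrier G)"
    and pos: "\<And>a. a \<in> A \<Longrightarrow> position s a = position t a"
    and weight: "\<And>a. a \<in> A \<Longrightarrow> weight A s a = c * weight A t a"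
  shows "word s - Poly_Mapping.single t c
    \<in> annihilator (carrier G) (\<lambda>w. weight A w \<one>)"
proof -
  have "Poly_Mapping.keys (word s - Poly_Mapping.single t c) \<subseteq> lists (carrier G)"
    using words keys_diff[of "word s" "Poly_Mapping.single t c"] by (auto split: if_splits)
  moreover have "weight A (u @ s @ v) \<one> = c * weight A (u @ t @ v) \<one>" for u v
  proof (cases "position v \<one> \<in> A")
    case True
    then show ?thesis by (simp add: weight_append position_append pos weight)
  next
    case False
    then show ?thesis using A by (simp add: weight_append weight_eq_0)
  qed
  ultimately show ?thesis
    by (simp add: annihilator_def linear_extension_diff)
qed

text \<open>The annihilator is an ideal, so only the generating relations have to be tested. The
  functional is the coordinate sum of the image of the basis vector at
  \<open>\<one>\<close>.\<close>

lemma twisted_ideal_subset_annihilator: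
  assumes A: "\<one> \<in> A" "A \<subseteq> carrier G"
    and cocycle: "\<And>a b c. a \<in> A \<Longrightarrow> b \<in> A \<Longrightarrow> c \<in> A \<Longrightarrow> cocycle_on a b c"
  shows "twisted_ideal G \<sigma> \<subseteq> annihilator (carrier G) (\<lambda>w. weight A w \<one>)"
proof -
  \<comment> \<open>This is the identity on the simplex
    \<open>\<one>, a, h \<otimes> a, g \<otimes> (h \<otimes> a)\<close>.\<close>
  have C: "\<sigma> g (h \<otimes> a) * \<sigma> h a = \<sigma> g h * \<sigma> (g \<otimes> h) a"
    if "g \<in> carrier G" "h \<in> carrier G" "a \<in> A" "h \<otimes> a \<in> A" "g \<otimes> (h \<otimes> a) \<in> A" for g h a
  proof -
    have a: "a \<in> carrier G" using that A by auto
    then have "g \<otimes> (h \<otimes> a) \<otimes> inv (h \<otimes> a) = g" "h \<otimes> a \<otimes> inv a = h"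
      using that by (simp_all add: m_assoc)
    then show ?thesis
      using cocycle[OF that(3-5)] by (simp add: cocycle_on_def cocycle_at_def)
  qed
  note mem = binomial_in_annihilator[OF A]
  have memA: "a \<in> carrier G" if "a \<in> A" for a using that A by auto
  have cancel: "inv g \<otimes> (g \<otimes> a) = a" "g \<otimes> (inv g \<otimes> a) = a"
    if "g \<in> carrier G" "a \<in> carrier G" for g a
    using that by (simp_all add: m_assoc[symmetric])
  have "twisted_relations G \<sigma> \<subseteq> annihilator (carrier G) (\<lambda>w. weight A w \<one>)"
  proof
    fix r assume "r \<in> twisted_relations G \<sigma>"
    then consider
      (L) g h where "g \<in> carrier G" "h \<in> carrier G"
        "r = word [inv g, g, h] - Poly_Mapping.single [inv g, g \<otimes> h] (\<sigma> g h)"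
    | (R) g h where "g \<in> carrier G" "h \<in> carrier G"
        "r = word [g, h, inv h] - Poly_Mapping.single [g \<otimes> h, inv h] (\<sigma> g h)"
    | (right) g where "g \<in> carrier G" "r = word [g, \<one>] - word [g]"
    | (left) g where "g \<in> carrier G" "r = word [\<one>, g] - word [g]"
    | (unit) "r = word [\<one>] - word []"
      unfolding twisted_relations_def using nonzero by auto
    then show "r \<in> annihilator (carrier G) (\<lambda>w. weight A w \<one>)"
    proof cases
      case L
      \<comment> \<open>The letter \<open>inv g\<close> leads back to \<open>h \<otimes> a\<close>,
        so both words require the same points to lie in \<open>A\<close>, and \<open>C\<close>
        compares the weights.\<close>
      show ?thesis unfolding L(3)
        using L(1,2) memA C[of g h] by (intro mem) (auto simp: m_assoc cancel)
    next
      case R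
      show ?thesis unfolding R(3)
      proof (rule mem)
        fix a assume a: "a \<in> A"
        \<comment> \<open>After \<open>inv h\<close>, the longer word passes through
          \<open>a\<close>, which already lies in \<open>A\<close>; hence \<open>C\<close> applies
          at \<open>inv h \<otimes> a\<close>.\<close>
        show "weight A [g, h, inv h] a = \<sigma> g h * weight A [g \<otimes> h, inv h] a"
          using R(1,2) a memA[OF a] C[of g h "inv h \<otimes> a"] by (auto simp: m_assoc cancel)
      qed (use R(1,2) memA in \<open>auto simp: m_assoc cancel\<close>)
    next
      case right
      show ?thesis unfolding right(2)
        using right(1) memA by (intro mem) (auto simp: factor_one_left)
    next
      case left
      show ?thesis unfolding left(2)
        using left(1) memA by (intro mem) (auto simp: factor_one_left)
    next
      case unit
      show ?thesis unfolding unit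
        using memA by (intro mem) (auto simp: factor_one_left)
    qed
  qed
  then show ?thesis
    unfolding twisted_ideal_def
    by (intro ring.genideal_minimal[OF ring_free_algebra] ideal_annihilator)
qed

section \<open>Membership of the word \<open>[x, y, z]\<close> in the ideal\<close>

lemma word_notin_twisted_ideal:
  assumes "x \<in> carrier G" "y \<in> carrier G" "z \<in> carrier G" and "cocycle_at G \<sigma> x y z"
  shows "word [x, y, z] \<notin> twisted_ideal G \<sigma>"
proof
  assume mem: "word [x, y, z] \<in> twisted_ideal G \<sigma>"
  \<comment> \<open>These are the points that the word visits from \<open>\<one>\<close>, so its
    weight is an untruncated product of nonzero values of \<open>\<sigma>\<close>.\<close>
  let ?A = "{\<one>, z, y \<otimes> z, x \<otimes> (y \<otimes> z)}"
  have "x \<otimes> (y \<otimes> z) \<otimes> inv (y \<otimes> z) = x" "y \<otimes> z \<otimes> inv z = y"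
    using assms by (simp_all add: m_assoc)
  then have "cocycle_on z (y \<otimes> z) (x \<otimes> (y \<otimes> z))"
    using assms by (simp add: cocycle_on_def)
  with assms have "cocycle_on a b c" if "a \<in> ?A" "b \<in> ?A" "c \<in> ?A" for a b c
    by (intro cocycle_on_closed[OF _ _ _ _ that]) auto
  then have "twisted_ideal G \<sigma> \<subseteq> annihilator (carrier G) (\<lambda>w. weight ?A w \<one>)"
    using assms by (intro twisted_ideal_subset_annihilator) auto
  then have "linear_extension (\<lambda>w. weight ?A ([] @ w @ []) \<one>) (word [x, y, z]) = 0"
    using mem unfolding annihilator_def by blast
  then show False using assms nonzero by simp
qed

text \<open>The padding argument for representations is repeated with words modulo the
  ideal.\<close>

lemma word_in_twisted_ideal:
  assumes xyz: "x \<in> carrier G" "y \<in> carrier G" "z \<in> carrier G" and "\<not> cocycle_at G \<sigma> x y z"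
  shows "word [x, y, z] \<in> twisted_ideal G \<sigma>"
proof -
  let ?F = "free_algebra (carrier G) :: ('g list \<Rightarrow>\<^sub>0 'k) ring"
  let ?I = "twisted_ideal G \<sigma>"
  \<comment> \<open>These names keep the facts about the group, since the interpretation below
    reuses the old ones for the free algebra.\<close>
  note group_one_closed = one_closed and group_assoc = m_assoc
  interpret ideal ?I ?F by (rule ideal_twisted_ideal) (rule is_group)
  have relations: "twisted_relations G \<sigma> \<subseteq> carrier ?F"
    unfolding twisted_relations_def by (auto dest!: subsetD[OF keys_diff] split: if_splits)
  have single_carrier: "Poly_Mapping.single w c \<in> carrier ?F" if "w \<in> lists (carrier G)" for w c
    using that by simp
  \<comment> \<open>Differences and scalar multiples come from multiplication by constants, that is,
    multiples of the empty word.\<close>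
  have diff: "p - q \<in> ?I" if "p \<in> ?I" "q \<in> ?I" for p q
  proof -
    have "Poly_Mapping.single [] (-1) \<otimes>\<^bsub>?F\<^esub> q \<in> ?I"
      using that by (intro I_l_closed) auto
    then have "p \<oplus>\<^bsub>?F\<^esub> (Poly_Mapping.single [] (-1) \<otimes>\<^bsub>?F\<^esub> q) \<in> ?I"
      using that by (intro additive_subgroup.a_closed[OF is_additive_subgroup])
    moreover have "Poly_Mapping.single [] (-1) * q = - q"
      by (simp add: single_uminus zero_list_def[symmetric])
    ultimately show ?thesis by simp
  qed
  have scale: "Poly_Mapping.single w (d * c) \<in> ?I" if "Poly_Mapping.single w c \<in> ?I" for w c d
    using I_l_closed[OF that single_carrier[of "[]" d]]
    by (simp add: mult_single plus_list_def)
  define cong where "cong p q \<longleftrightarrow> p - q \<in> ?I" for p q :: "'g list \<Rightarrow>\<^sub>0 'k"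
  have trans [trans]: "cong p r" if "cong p q" "cong q r" for p q r
    using additive_subgroup.a_closed[OF is_additive_subgroup, of "p - q" "q - r"] that by (simp add: cong_def)
  have rewrite: "cong (Poly_Mapping.single (u @ s @ v) c) (Poly_Mapping.single (u @ t @ v) (c * d))"
    if rel: "word s - Poly_Mapping.single t d \<in> twisted_relations G \<sigma>"
      and uv: "u \<in> lists (carrier G)" "v \<in> lists (carrier G)" for u v s t c d
  proof -
    have "word s - Poly_Mapping.single t d \<in> ?I"
      using rel ring.genideal_self[OF ring_free_algebra relations]
      unfolding twisted_ideal_def by blast
    then have "(Poly_Mapping.single u c \<otimes>\<^bsub>?F\<^esub> (word s - Poly_Mapping.single t d)) \<otimes>\<^bsub>?F\<^esub> word v \<in> ?I"
      using uv by (intro I_l_closed I_r_closed single_carrier)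
    then show ?thesis
      by (simp add: cong_def algebra_simps mult_single plus_list_def)
  qed
  have relation_mem:
    "word [inv g, g, h] - Poly_Mapping.single [inv g, g \<otimes> h] (\<sigma> g h) \<in> twisted_relations G \<sigma>"
    "word [g, h, inv h] - Poly_Mapping.single [g \<otimes> h, inv h] (\<sigma> g h) \<in> twisted_relations G \<sigma>"
    "word [g, \<one>] - word [g] \<in> twisted_relations G \<sigma>"
    "word [\<one>, g] - word [g] \<in> twisted_relations G \<sigma>"
    if "g \<in> carrier G" "h \<in> carrier G" for g h
    using that unfolding twisted_relations_def by blast+
  note L = rewrite[OF relation_mem(1)] and R = rewrite[OF relation_mem(2)]
  note right = rewrite[OF relation_mem(3)[OF _ group_one_closed]]
    and left = rewrite[OF relation_mem(4)[OF _ group_one_closed]]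
  \<comment> \<open>Three reductions of the padded word follow: two to multiples of
    \<open>?W\<close>, one to a nonzero multiple of \<open>[x, y, z]\<close>.\<close>
  let ?N = "word [x, inv x, x, y, z, inv z, z] :: 'g list \<Rightarrow>\<^sub>0 'k"
  let ?W = "[x, inv x, x \<otimes> y \<otimes> z, inv z, z]"
  have "cong ?N (Poly_Mapping.single [x, inv x, x \<otimes> y, z, inv z, z] (\<sigma> x y))"
    using L[of x y "[x]" "[z, inv z, z]" 1] xyz by simp
  also have "cong \<dots> (Poly_Mapping.single ?W (\<sigma> x y * \<sigma> (x \<otimes> y) z))"
    using R[of "x \<otimes> y" z "[x, inv x]" "[z]"] xyz by simp
  finally have 1: "cong ?N (Poly_Mapping.single ?W (\<sigma> x y * \<sigma> (x \<otimes> y) z))" .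
  have "cong ?N (Poly_Mapping.single [x, inv x, x, y \<otimes> z, inv z, z] (\<sigma> y z))"
    using R[of y z "[x, inv x, x]" "[z]" 1] xyz by simp
  also have "cong \<dots> (Poly_Mapping.single ?W (\<sigma> y z * \<sigma> x (y \<otimes> z)))"
    using L[of x "y \<otimes> z" "[x]" "[inv z, z]"] xyz by (simp add: group_assoc)
  finally have 2: "cong ?N (Poly_Mapping.single ?W (\<sigma> y z * \<sigma> x (y \<otimes> z)))" .
  have "cong ?N (Poly_Mapping.single [x, \<one>, y, z, inv z, z] (\<sigma> (inv x) x))"
    using L[of "inv x" x "[]" "[y, z, inv z, z]" 1] xyz by simp
  also have "cong \<dots> (Poly_Mapping.single [x, y, z, inv z, z] (\<sigma> (inv x) x))"
    using right[of x "[]" "[y, z, inv z, z]"] xyz by simp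
  also have "cong \<dots> (Poly_Mapping.single [x, y, \<one>, z] (\<sigma> (inv x) x * \<sigma> z (inv z)))"
    using R[of z "inv z" "[x, y]" "[]"] xyz by simp
  also have "cong \<dots> (Poly_Mapping.single [x, y, z] (\<sigma> (inv x) x * \<sigma> z (inv z)))"
    using left[of z "[x, y]" "[]"] xyz by simp
  finally have 3: "cong ?N (Poly_Mapping.single [x, y, z] (\<sigma> (inv x) x * \<sigma> z (inv z)))" .
  define \<delta> where "\<delta> = \<sigma> y z * \<sigma> x (y \<otimes> z) - \<sigma> x y * \<sigma> (x \<otimes> y) z"
  have "\<delta> \<noteq> 0" using assms by (simp add: \<delta>_def cocycle_at_def mult.commute)
  \<comment> \<open>Subtracting the first two congruences eliminates \<open>?N\<close>. As
    \<open>\<delta>\<close> is nonzero, all multiples of \<open>?W\<close> lie in the ideal, hence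
    \<open>?N\<close> does too.\<close>
  have "Poly_Mapping.single ?W \<delta> \<in> ?I"
    using diff[OF 1[unfolded cong_def] 2[unfolded cong_def]] by (simp add: \<delta>_def single_diff)
  then have W: "Poly_Mapping.single ?W c \<in> ?I" for c
    using scale[of ?W \<delta> "c / \<delta>"] \<open>\<delta> \<noteq> 0\<close> by simp
  have "?N \<in> ?I"
    using additive_subgroup.a_closed[OF is_additive_subgroup 1[unfolded cong_def] W[of "\<sigma> x y * \<sigma> (x \<otimes> y) z"]] by simp
  then have "Poly_Mapping.single [x, y, z] (\<sigma> (inv x) x * \<sigma> z (inv z)) \<in> ?I"
    using diff[OF _ 3[unfolded cong_def]] by fastforce
  then show ?thesis
    using scale[of "[x, y, z]" "\<sigma> (inv x) x * \<sigma> z (inv z)" "1 / (\<sigma> (inv x) x * \<sigma> z (inv z))"]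
      nonzero xyz by simp
qed

end

section \<open>Passage to cosets in the quotient algebra\<close>

theorem proposition7p4:
  fixes G :: "('g, 'm) monoid_scheme" (structure)
    and \<sigma> :: "'g \<Rightarrow> 'g \<Rightarrow> 'k::alg_closed_field"
    and x y z :: 'g
  assumes "group G"
    and "\<sigma> \<in> pm TYPE('r::ring_1) G"
    and "\<forall>g\<in>carrier G. \<forall>h\<in>carrier G. \<sigma> g h \<noteq> 0"
    and "x \<in> carrier G" and "y \<in> carrier G" and "z \<in> carrier G"
  shows "bracket G \<sigma> x \<otimes>\<^bsub>twisted_partial_group_algebra G \<sigma>\<^esub> bracket G \<sigma> y
             \<otimes>\<^bsub>twisted_partial_group_algebra G \<sigma>\<^esub> bracket G \<sigma> z
           = \<zero>\<^bsub>twisted_partial_group_algebra G \<sigma>\<^esub>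
         \<longleftrightarrow> \<sigma> x y * \<sigma> (x \<otimes> y) z \<noteq> \<sigma> x (y \<otimes> z) * \<sigma> y z"
proof -
  obtain scale :: "'k \<Rightarrow> 'r \<Rightarrow> 'r" and \<Gamma> where rep: "partial_projective_rep G scale \<sigma> \<Gamma>"
    using assms(2) by (auto simp: pm_def)
  then have "unital_algebra scale" by (simp add: partial_projective_rep_def)
  then have "total_factor_set G \<sigma>"
    using unital_algebra.total_factor_set_if_rep[OF _ assms(1) rep] assms(3) by blast
  then interpret total_factor_set G \<sigma> .
  interpret ideal "twisted_ideal G \<sigma>" "free_algebra (carrier G)"
    by (rule ideal_twisted_ideal) (rule is_group)
  \<comment> \<open>Multiplying cosets of words concatenates the words, so the product of brackets
    is the coset of a single word.\<close>
  have coset_mult: "(twisted_ideal G \<sigma> +>\<^bsub>free_algebra (carrier G)\<^esub> word u)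
      \<otimes>\<^bsub>twisted_partial_group_algebra G \<sigma>\<^esub> (twisted_ideal G \<sigma> +>\<^bsub>free_algebra (carrier G)\<^esub> word v)
    = twisted_ideal G \<sigma> +>\<^bsub>free_algebra (carrier G)\<^esub> word (u @ v)"
    if "u \<in> lists (carrier G)" "v \<in> lists (carrier G)" for u v
    using rcoset_mult_add[of "word u" "word v"] that
    by (simp add: twisted_partial_group_algebra_def FactRing_def mult_single plus_list_def)
  have "bracket G \<sigma> x \<otimes>\<^bsub>twisted_partial_group_algebra G \<sigma>\<^esub> bracket G \<sigma> y
      \<otimes>\<^bsub>twisted_partial_group_algebra G \<sigma>\<^esub> bracket G \<sigma> z
    = twisted_ideal G \<sigma> +>\<^bsub>free_algebra (carrier G)\<^esub> word [x, y, z]"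
    using assms(4-6) by (simp add: bracket_def coset_mult)
  moreover have "twisted_ideal G \<sigma> +>\<^bsub>free_algebra (carrier G)\<^esub> word [x, y, z] = twisted_ideal G \<sigma>
      \<longleftrightarrow> word [x, y, z] \<in> twisted_ideal G \<sigma>"
  proof
    assume "twisted_ideal G \<sigma> +>\<^bsub>free_algebra (carrier G)\<^esub> word [x, y, z] = twisted_ideal G \<sigma>"
    then show "word [x, y, z] \<in> twisted_ideal G \<sigma>"
      by (rule a_coset_join1) (use assms(4-6) a_subgroup in simp_all)
  qed (rule a_rcos_const)
  moreover have "word [x, y, z] \<in> twisted_ideal G \<sigma> \<longleftrightarrow> \<not> cocycle_at G \<sigma> x y z"
    using word_in_twisted_ideal[OF assms(4-6)] word_notin_twisted_ideal[OF assms(4-6)] by blast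
  moreover have "\<zero>\<^bsub>twisted_partial_group_algebra G \<sigma>\<^esub> = twisted_ideal G \<sigma>"
    by (simp add: twisted_partial_group_algebra_def FactRing_def)
  ultimately show ?thesis
    by (simp only: cocycle_at_def)
qed

end
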